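(* Let $u$ be a linear operator from real $\ell_1^3$ to real $\ell_2^2$ such that $ue_1,ue_2,ue_3$ have norm one and every two of them are linearly independent. Then $\pi_2(u)>1$.
   Context: Scalars are real; $e_1,e_2,e_3$ is the unit vector basis of $\ell_1^3$. For an operator $T:X\to Y$ between Banach spaces, $\pi_2(T)=\sup\big(\sum_{i=1}^n\|TUf_i\|^2\big)^{1/2}$, the supremum over all $n\ge1$ and operators $U:\ell_2^n\to X$ with $\|U\|\le1$, where $(f_i)$ is the unit vector basis of $\ell_2^n$. *)

theory Defs
  imports "HOL-Analysis.Analysis"
begin

text \<open>The space \<open>\<ell>\<^sub>1\<^sup>n\<close>, with \<open>n = CARD('n)\<close>: a copy of \<open>real ^ 'n\<close> with the sum norm.\<close>

typedef 'n l1 = "UNIV :: (real ^ 'n::finite) set"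
  morphisms l1_vec L1
  by simp

setup_lifting type_definition_l1

instantiation l1 :: (finite) real_normed_vector
begin

lift_definition zero_l1 :: "'a l1" is 0 .
lift_definition plus_l1 :: "'a l1 \<Rightarrow> 'a l1 \<Rightarrow> 'a l1" is "(+)" .
lift_definition minus_l1 :: "'a l1 \<Rightarrow> 'a l1 \<Rightarrow> 'a l1" is "(-)" .
lift_definition uminus_l1 :: "'a l1 \<Rightarrow> 'a l1" is uminus .
lift_definition scaleR_l1 :: "real \<Rightarrow> 'a l1 \<Rightarrow> 'a l1" is scaleR .
lift_definition norm_l1 :: "'a l1 \<Rightarrow> real" is "\<lambda>x. \<Sum>i\<in>UNIV. \<bar>x $ i\<bar>" .
definition sgn_l1 :: "'a l1 \<Rightarrow> 'a l1" where "sgn_l1 x = scaleR (inverse (norm x)) x"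
definition dist_l1 :: "'a l1 \<Rightarrow> 'a l1 \<Rightarrow> real" where "dist_l1 x y = norm (x - y)"
definition uniformity_l1 :: "('a l1 \<times> 'a l1) filter"
  where "uniformity_l1 = (INF e\<in>{0 <..}. principal {(x, y). dist x y < e})"
definition open_l1 :: "'a l1 set \<Rightarrow> bool"
  where "open_l1 S = (\<forall>x\<in>S. \<forall>\<^sub>F (x', y) in uniformity. x' = x \<longrightarrow> y \<in> S)"

instance
proof
  fix x y z :: "'a l1" and a b :: real and S :: "'a l1 set"
  show "x + y + z = x + (y + z)" "x + y = y + x" "0 + x = x" "- x + x = 0" "x - y = x + - y"
    by (transfer; simp add: algebra_simps)+
  show "a *\<^sub>R (x + y) = a *\<^sub>R x + a *\<^sub>R y" "(a + b) *\<^sub>R x = a *\<^sub>R x + b *\<^sub>R x"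
    "a *\<^sub>R b *\<^sub>R x = (a * b) *\<^sub>R x" "1 *\<^sub>R x = x"
    by (transfer; simp add: algebra_simps)+
  show "norm x = 0 \<longleftrightarrow> x = 0"
    by transfer (simp add: sum_nonneg_eq_0_iff vec_eq_iff)
  show "norm (x + y) \<le> norm x + norm y"
    by transfer (simp add: sum.distrib[symmetric] sum_mono abs_triangle_ineq)
  show "norm (a *\<^sub>R x) = \<bar>a\<bar> * norm x"
    by transfer (simp add: abs_mult sum_distrib_left)
qed (rule sgn_l1_def dist_l1_def uniformity_l1_def open_l1_def)+

end

lemma norm_l1_vec_le: "norm (l1_vec x) \<le> norm x"
  by transfer (rule norm_le_l1_cart)

instance l1 :: (finite) banach
proof
  fix X :: "nat \<Rightarrow> 'a l1"
  assume X: "Cauchy X"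
  have "Cauchy (\<lambda>n. l1_vec (X n))"
  proof (rule CauchyI)
    fix e :: real
    assume "0 < e"
    then obtain M where M: "\<And>m n. m \<ge> M \<Longrightarrow> n \<ge> M \<Longrightarrow> norm (X m - X n) < e"
      using CauchyD[OF X, of e] by auto
    have "norm (l1_vec (X m) - l1_vec (X n)) < e" if "m \<ge> M" "n \<ge> M" for m n
      using norm_l1_vec_le[of "X m - X n"] M[OF that] by (simp add: minus_l1.rep_eq)
    then show "\<exists>M. \<forall>m\<ge>M. \<forall>n\<ge>M. norm (l1_vec (X m) - l1_vec (X n)) < e"
      by blast
  qed
  then obtain l where l: "(\<lambda>n. l1_vec (X n)) \<longlonglongrightarrow> l"
    by (metis Cauchy_convergent convergentD)
  have "(\<lambda>n. \<Sum>i\<in>UNIV. \<bar>l1_vec (X n) $ i - l $ i\<bar>) \<longlonglongrightarrow> (\<Sum>i\<in>UNIV. \<bar>l $ i - l $ i\<bar>)"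
    by (intro tendsto_sum tendsto_rabs tendsto_diff tendsto_vec_nth tendsto_const l)
  then have "(\<lambda>n. norm (X n - L1 l)) \<longlonglongrightarrow> 0"
    by (simp add: norm_l1.rep_eq minus_l1.rep_eq L1_inverse)
  then have "X \<longlonglongrightarrow> L1 l"
    by (rule LIM_zero_cancel[OF tendsto_norm_zero_cancel])
  then show "convergent X"
    by (rule convergentI)
qed

definition l1_unit :: "'n::finite \<Rightarrow> 'n l1"
  where "l1_unit i = L1 (axis i 1)"

text \<open>The supremum in the definition of \<open>\<pi>\<^sub>2\<close> ranges over all dimensions \<open>n\<close>, so \<open>\<ell>\<^sub>2\<^sup>n\<close> cannot be
  a type here.  It is the set of real sequences vanishing from index \<open>n\<close> on, with
  norm \<open>\<lambda>a. L2_set a {..<n}\<close>.\<close>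

definition l2_carrier :: "nat \<Rightarrow> (nat \<Rightarrow> real) set"
  where "l2_carrier n = {a. \<forall>i\<ge>n. a i = 0}"

definition l2_unit :: "nat \<Rightarrow> nat \<Rightarrow> real"
  where "l2_unit i = (\<lambda>j. if j = i then 1 else 0)"

definition l2_linear :: "nat \<Rightarrow> ((nat \<Rightarrow> real) \<Rightarrow> 'a::real_vector) \<Rightarrow> bool"
  where "l2_linear n U \<longleftrightarrow>
    (\<forall>a\<in>l2_carrier n. \<forall>b\<in>l2_carrier n. U (\<lambda>i. a i + b i) = U a + U b) \<and>
    (\<forall>c. \<forall>a\<in>l2_carrier n. U (\<lambda>i. c * a i) = c *\<^sub>R U a)"

text \<open>The linear maps from \<open>\<ell>\<^sub>2\<^sup>n\<close> of operator norm at most one.\<close>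

definition l2_contraction :: "nat \<Rightarrow> ((nat \<Rightarrow> real) \<Rightarrow> 'a::real_normed_vector) \<Rightarrow> bool"
  where "l2_contraction n U \<longleftrightarrow>
    l2_linear n U \<and> (\<forall>a\<in>l2_carrier n. norm (U a) \<le> L2_set a {..<n})"

text \<open>The supremum is taken in \<open>ereal\<close>, since it can be infinite.\<close>

definition pi2 :: "('a::banach \<Rightarrow> 'b::banach) \<Rightarrow> ereal"
  where "pi2 T = Sup {ereal (sqrt (\<Sum>i<n. (norm (T (U (l2_unit i))))\<^sup>2)) | n U.
    n \<ge> 1 \<and> l2_contraction n U}"

end

theory Submission
  imports Defs
begin

text \<open>Let \<open>a, b, c\<close> be the pairwise inner products of the images of the unit vectors. These lie in a
  plane, so \<open>a, b, c\<close> satisfy the Gram relation; as \<open>a, b, c\<close> are different from \<open>\<plusminus>1\<close>, the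
  Gram matrix lies outside the cut polytope, so after changing signs of the unit vectors
  \<open>a + b + c < -1\<close>. For three planar vectors of length \<open>1/2\<close> at mutual angles of 120 degrees
  every signed sum has norm at most one, so they define a contraction \<open>\<ell>\<^sub>2\<^sup>2 \<rightarrow> \<ell>\<^sub>1\<^sup>3\<close>, and it
  gives \<open>\<pi>\<^sub>2(u)\<^sup>2 \<ge> 3/4 - (a + b + c)/4 > 1\<close>.\<close>

text \<open>Equality in Cauchy-Schwarz for unit vectors would force \<open>v = w\<close> or
  \<open>v = - w\<close>. The case \<open>v = w\<close> is excluded separately because
  \<open>{v, w}\<close> is then a singleton, which is independent.\<close>

lemma abs_inner_less_1_if_independent:
  fixes v w :: "'a::real_inner"
  assumes "norm v = 1" "norm w = 1" "v \<noteq> w" "independent {v, w}"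
  shows "\<bar>v \<bullet> w\<bar> < 1"
proof -
  have "v \<noteq> - w"
  proof
    assume "v = - w"
    then have "v \<in> span {w}"
      by (simp add: span_base span_neg)
    with assms show False
      by (simp add: independent_insert)
  qed
  moreover have "\<bar>v \<bullet> w\<bar> \<le> 1"
    using Cauchy_Schwarz_ineq2[of v w] assms by simp
  moreover have "v \<bullet> w \<noteq> 1" "v \<bullet> w \<noteq> - 1"
    using norm_cauchy_schwarz_abs_eq[of v w] norm_cauchy_schwarz_eq[of v w] assms \<open>v \<noteq> - w\<close>
    by (auto simp: abs_if split: if_splits)
  ultimately show ?thesis
    by linarith
qed

text \<open>Three vectors in a plane are linearly dependent, so their Gram determinant
  vanishes.\<close>

lemma gram_relation_plane:
  fixes x y z :: "real ^ 2"
  assumes "norm x = 1" "norm y = 1" "norm z = 1"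
  shows "1 + 2 * (x \<bullet> y) * (x \<bullet> z) * (y \<bullet> z) = (x \<bullet> y)\<^sup>2 + (x \<bullet> z)\<^sup>2 + (y \<bullet> z)\<^sup>2"
proof -
  have "(x \<bullet> x) * (y \<bullet> y) * (z \<bullet> z) + 2 * (x \<bullet> y) * (x \<bullet> z) * (y \<bullet> z)
    = (x \<bullet> y)\<^sup>2 * (z \<bullet> z) + (x \<bullet> z)\<^sup>2 * (y \<bullet> y) + (y \<bullet> z)\<^sup>2 * (x \<bullet> x)"
    unfolding inner_vec_def sum_2 inner_real_def by algebra
  moreover have "x \<bullet> x = 1" "y \<bullet> y = 1" "z \<bullet> z = 1"
    using assms by (simp_all add: norm_eq_1)
  ultimately show ?thesis
    by simp
qed

lemma gram_relation_outside_cut_polytope: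
  fixes a b c :: real
  assumes gram: "1 + 2 * a * b * c = a\<^sup>2 + b\<^sup>2 + c\<^sup>2"
    and less: "\<bar>a\<bar> < 1" "\<bar>b\<bar> < 1" "\<bar>c\<bar> < 1"
  shows "a + b + c < -1 \<or> a - b - c < -1 \<or> b - a - c < -1 \<or> c - a - b < -1"
proof (rule ccontr)
  assume "\<not> ?thesis"
  then have le: "\<bar>b + c\<bar> \<le> 1 + a" "\<bar>b - c\<bar> \<le> 1 - a"
    by linarith+
  have "(b + c)\<^sup>2 \<le> (1 + a)\<^sup>2" "(b - c)\<^sup>2 \<le> (1 - a)\<^sup>2"
    using le by (simp_all add: abs_le_square_iff[symmetric])
  \<comment> \<open>The left side is twice the Gram determinant. Both brackets are nonnegative and
    have positive weights, so both must vanish.\<close>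
  moreover have "(1 - a) * ((1 + a)\<^sup>2 - (b + c)\<^sup>2) + (1 + a) * ((1 - a)\<^sup>2 - (b - c)\<^sup>2) = 0"
    using gram by algebra
  moreover have "1 - a > 0" "1 + a > 0"
    using less by linarith+
  ultimately have "(b + c)\<^sup>2 = (1 + a)\<^sup>2" "(b - c)\<^sup>2 = (1 - a)\<^sup>2"
    by (smt (verit) mult_pos_pos mult_nonneg_nonneg)+
  then have "\<bar>b + c\<bar> = \<bar>1 + a\<bar>" "\<bar>b - c\<bar> = \<bar>1 - a\<bar>"
    by (simp_all add: power2_eq_iff abs_eq_iff)
  \<comment> \<open>Adding the two equations gives
    \<open>2 * max \<bar>b\<bar> \<bar>c\<bar> = 2\<close>.\<close>
  with less show False
    by linarith
qed

lemma norm_l1_3: "norm (L1 x :: 3 l1) = \<bar>x $ 1\<bar> + \<bar>x $ 2\<bar> + \<bar>x $ 3\<bar>"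
  by (simp add: norm_l1.rep_eq L1_inverse sum_3)

lemma linear_l1_3_apply:
  fixes u :: "3 l1 \<Rightarrow> 'a::real_vector"
  assumes "linear u"
  shows "u (L1 x) = x $ 1 *\<^sub>R u (l1_unit 1) + x $ 2 *\<^sub>R u (l1_unit 2) + x $ 3 *\<^sub>R u (l1_unit 3)"
proof -
  have "L1 x = x $ 1 *\<^sub>R l1_unit 1 + x $ 2 *\<^sub>R l1_unit 2 + x $ 3 *\<^sub>R l1_unit 3"
    unfolding l1_unit_def l1_vec_inject[symmetric] plus_l1.rep_eq scaleR_l1.rep_eq
    by (simp add: L1_inverse vec_eq_iff forall_3 axis_def)
  then show ?thesis
    by (simp add: linear_add[OF assms] linear_scale[OF assms])
qed

lemma pi2_upper:
  assumes "n \<ge> 1" "l2_contraction n U"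
  shows "ereal (sqrt (\<Sum>i<n. (norm (T (U (l2_unit i))))\<^sup>2)) \<le> pi2 T"
  unfolding pi2_def using assms by (intro Sup_upper) blast

text \<open>Up to the signs \<open>s\<close>, the coordinates are the inner products of
  \<open>(a 0, a 1)\<close> with \<open>(1/2, 0)\<close> and
  \<open>(- 1/4, \<plusminus> sqrt 3 / 4)\<close>.\<close>

definition tripod :: "real ^ 3 \<Rightarrow> (nat \<Rightarrow> real) \<Rightarrow> 3 l1"
  where "tripod s a = L1 (vector [s $ 1 * (a 0 / 2), s $ 2 * ((sqrt 3 * a 1 - a 0) / 4),
    s $ 3 * ((- sqrt 3 * a 1 - a 0) / 4)])"

text \<open>As \<open>\<bar>z - x\<bar> + \<bar>z + x\<bar>\<close> is twice the larger of
  \<open>\<bar>x\<bar>\<close> and \<open>\<bar>z\<bar>\<close>, the left side is the larger of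
  \<open>\<bar>x\<bar>\<close> and
  \<open>(\<bar>x\<bar> + sqrt 3 * \<bar>y\<bar>) / 2\<close>.\<close>

lemma tripod_ineq:
  fixes x y :: real
  shows "\<bar>x / 2\<bar> + \<bar>(sqrt 3 * y - x) / 4\<bar> + \<bar>(- sqrt 3 * y - x) / 4\<bar> \<le> sqrt (x\<^sup>2 + y\<^sup>2)"
proof -
  have le1: "\<bar>x\<bar> \<le> sqrt (x\<^sup>2 + y\<^sup>2)"
    by (simp add: real_le_rsqrt)
  \<comment> \<open>This is Lagrange's identity behind Cauchy-Schwarz for the unit vector
    \<open>(1/2, sqrt 3 / 2)\<close>.\<close>
  have sq: "x\<^sup>2 + y\<^sup>2 - ((\<bar>x\<bar> + sqrt 3 * \<bar>y\<bar>) / 2)\<^sup>2 = ((sqrt 3 * \<bar>x\<bar> - \<bar>y\<bar>) / 2)\<^sup>2"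
    by (simp add: field_simps power2_eq_square)
  have "((\<bar>x\<bar> + sqrt 3 * \<bar>y\<bar>) / 2)\<^sup>2 \<le> x\<^sup>2 + y\<^sup>2"
    using sq zero_le_power2[of "(sqrt 3 * \<bar>x\<bar> - \<bar>y\<bar>) / 2"] by linarith
  from real_le_rsqrt[OF this] have le2: "(\<bar>x\<bar> + \<bar>sqrt 3 * y\<bar>) / 2 \<le> sqrt (x\<^sup>2 + y\<^sup>2)"
    by (simp add: abs_mult)
  \<comment> \<open>With \<open>z\<close> in place of \<open>sqrt 3 * y\<close> the claim is
    piecewise linear.\<close>
  have "\<bar>x / 2\<bar> + \<bar>(z - x) / 4\<bar> + \<bar>(- z - x) / 4\<bar> \<le> r"
    if "\<bar>x\<bar> \<le> r" "(\<bar>x\<bar> + \<bar>z\<bar>) / 2 \<le> r" for z r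
    using that unfolding add_divide_distrib diff_divide_distrib by linarith
  from this[OF le1 le2] show ?thesis
    by simp
qed

lemma l2_contraction_tripod:
  assumes "\<And>i. \<bar>s $ i\<bar> = 1"
  shows "l2_contraction 2 (tripod s)"
  unfolding l2_contraction_def l2_linear_def
proof (intro conjI ballI allI)
  fix a b :: "nat \<Rightarrow> real" and c :: real
  show "tripod s (\<lambda>i. a i + b i) = tripod s a + tripod s b"
    unfolding tripod_def l1_vec_inject[symmetric] plus_l1.rep_eq
    by (simp add: L1_inverse vec_eq_iff forall_3 vector_3 field_simps)
  show "tripod s (\<lambda>i. c * a i) = c *\<^sub>R tripod s a"
    unfolding tripod_def l1_vec_inject[symmetric] scaleR_l1.rep_eq
    by (simp add: L1_inverse vec_eq_iff forall_3 vector_3 field_simps)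
  have "norm (tripod s a)
    = \<bar>a 0 / 2\<bar> + \<bar>(sqrt 3 * a 1 - a 0) / 4\<bar> + \<bar>(- sqrt 3 * a 1 - a 0) / 4\<bar>"
    unfolding tripod_def norm_l1_3 vector_3 abs_mult[of "s $ _"] assms mult_1 ..
  also have "\<dots> \<le> sqrt ((a 0)\<^sup>2 + (a 1)\<^sup>2)"
    by (rule tripod_ineq)
  also have "\<dots> = L2_set a {..<2}"
    by (simp add: L2_set_def numeral_2_eq_2)
  finally show "norm (tripod s a) \<le> L2_set a {..<2}" .
qed

text \<open>The tripod vectors have squared length \<open>1/4\<close> and mutual inner products
  \<open>- 1/8\<close>; these are the coefficients of the squares and of the mixed terms, each mixed
  term occurring twice.\<close>

lemma tripod_norms:
  fixes x y z :: "'a::real_inner"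
  assumes "norm x = 1" "norm y = 1" "norm z = 1"
  shows "(norm ((1 / 2) *\<^sub>R x + (- 1 / 4) *\<^sub>R y + (- 1 / 4) *\<^sub>R z))\<^sup>2
      + (norm ((sqrt 3 / 4) *\<^sub>R y + (- sqrt 3 / 4) *\<^sub>R z))\<^sup>2
    = 3 / 4 - (x \<bullet> y + x \<bullet> z + y \<bullet> z) / 4"
proof -
  have "x \<bullet> x = 1" "y \<bullet> y = 1" "z \<bullet> z = 1"
    using assms by (simp_all add: norm_eq_1)
  then show ?thesis
    unfolding power2_norm_eq_inner
    by (simp add: inner_add_left inner_add_right inner_diff_left inner_diff_right
        inner_commute[of y x] inner_commute[of z x] inner_commute[of z y] field_simps)
qed

lemma pi2_gt_1_if_inner_sum_less:
  fixes u :: "3 l1 \<Rightarrow> 'a::{real_inner, banach}" and s :: "real ^ 3"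
  assumes "linear u" and unit: "\<And>i. norm (u (l1_unit i)) = 1" and s: "\<And>i. \<bar>s $ i\<bar> = 1"
    and less: "(s $ 1 * s $ 2) * (u (l1_unit 1) \<bullet> u (l1_unit 2))
      + (s $ 1 * s $ 3) * (u (l1_unit 1) \<bullet> u (l1_unit 3))
      + (s $ 2 * s $ 3) * (u (l1_unit 2) \<bullet> u (l1_unit 3)) < -1"
  shows "pi2 u > 1"
proof -
  \<comment> \<open>The signs in \<open>tripod s\<close> move onto the images, so only the unsigned
    tripod acts on the unit vectors \<open>v i\<close>.\<close>
  define v where "v i = s $ i *\<^sub>R u (l1_unit i)" for i
  have v: "norm (v i) = 1" for i
    by (simp add: v_def unit s)
  have less': "v 1 \<bullet> v 2 + v 1 \<bullet> v 3 + v 2 \<bullet> v 3 < -1"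
    using less by (simp add: v_def mult_ac)
  have apply0: "u (tripod s (l2_unit 0)) = (1 / 2) *\<^sub>R v 1 + (- 1 / 4) *\<^sub>R v 2 + (- 1 / 4) *\<^sub>R v 3"
    by (simp add: tripod_def l2_unit_def linear_l1_3_apply[OF \<open>linear u\<close>] vector_3 v_def)
  have apply1: "u (tripod s (l2_unit 1)) = (sqrt 3 / 4) *\<^sub>R v 2 + (- sqrt 3 / 4) *\<^sub>R v 3"
    by (simp add: tripod_def l2_unit_def linear_l1_3_apply[OF \<open>linear u\<close>] vector_3 v_def mult.commute)
  have "(\<Sum>i<2. (norm (u (tripod s (l2_unit i))))\<^sup>2)
    = (norm (u (tripod s (l2_unit 0))))\<^sup>2 + (norm (u (tripod s (l2_unit 1))))\<^sup>2"
    by (simp add: numeral_2_eq_2)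
  also have "\<dots> = 3 / 4 - (v 1 \<bullet> v 2 + v 1 \<bullet> v 3 + v 2 \<bullet> v 3) / 4"
    unfolding apply0 apply1 by (rule tripod_norms) (rule v)+
  also from less' have "\<dots> > 1"
    by (simp add: field_simps)
  finally have "1 < ereal (sqrt (\<Sum>i<2. (norm (u (tripod s (l2_unit i))))\<^sup>2))"
    by simp
  also have "\<dots> \<le> pi2 u"
    by (rule pi2_upper) (simp_all add: l2_contraction_tripod s)
  finally show ?thesis .
qed

theorem proposition3p1:
  fixes u :: "3 l1 \<Rightarrow> real ^ 2"
  assumes "linear u"
    and "\<And>i. norm (u (l1_unit i)) = 1"
    and "\<And>i j. i \<noteq> j \<Longrightarrow>
      u (l1_unit i) \<noteq> u (l1_unit j) \<and> independent {u (l1_unit i), u (l1_unit j)}"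
  shows "pi2 u > 1"
proof -
  let ?a = "u (l1_unit 1) \<bullet> u (l1_unit 2)"
  let ?b = "u (l1_unit 1) \<bullet> u (l1_unit 3)"
  let ?c = "u (l1_unit 2) \<bullet> u (l1_unit 3)"
  have "\<bar>u (l1_unit i) \<bullet> u (l1_unit j)\<bar> < 1" if "i \<noteq> j" for i j
    using assms(2) assms(3)[OF that] by (intro abs_inner_less_1_if_independent) auto
  then have "?a + ?b + ?c < -1 \<or> ?a - ?b - ?c < -1 \<or> ?b - ?a - ?c < -1 \<or> ?c - ?a - ?b < -1"
    by (intro gram_relation_outside_cut_polytope gram_relation_plane assms(2)) simp_all
  \<comment> \<open>Negating the third, second or first sign keeps only the coefficient of
    \<open>?a\<close>, \<open>?b\<close> or \<open>?c\<close> respectively, which yields the last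
    three disjuncts.\<close>
  then obtain s :: "real ^ 3" where "\<forall>i. \<bar>s $ i\<bar> = 1"
    and "(s $ 1 * s $ 2) * ?a + (s $ 1 * s $ 3) * ?b + (s $ 2 * s $ 3) * ?c < -1"
  proof (elim disjE)
    assume "?a + ?b + ?c < -1"
    then show ?thesis
      by (intro that[of "vector [1, 1, 1]"]) (simp_all add: forall_3 vector_3)
  next
    assume "?a - ?b - ?c < -1"
    then show ?thesis
      by (intro that[of "vector [1, 1, -1]"]) (simp_all add: forall_3 vector_3)
  next
    assume "?b - ?a - ?c < -1"
    then show ?thesis
      by (intro that[of "vector [1, -1, 1]"]) (simp_all add: forall_3 vector_3)
  next
    assume "?c - ?a - ?b < -1"
    then show ?thesis
      by (intro that[of "vector [-1, 1, 1]"]) (simp_all add: forall_3 vector_3)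
  qed
  then show ?thesis
    using assms(1,2) by (intro pi2_gt_1_if_inner_sum_less[of u s]) simp_all
qed

end
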